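(* Let $\{\Psi_t\}_{t\geq0}$ be a strongly continuous semigroup of bounded linear operators on a Banach space $X$, let $\{\Psi_t^\sharp\}_{t\geq0}$ be the associated dual $w^*$-continuous semigroup of operators on the topological dual $X^\sharp$, and let $\psi^\sharp$ be the $w^*$-infinitesimal generator of $\{\Psi_t^\sharp\}_{t\geq0}$. For $f\in X^\sharp$, the following assertions are equivalent: (i) $\Psi_t^\sharp(f)=f$ for all real $t\geq0$. (ii) $f\in\ker(\psi^\sharp)$, that is, $f\in\operatorname{Dom}(\psi^\sharp)$ and $\psi^\sharp(f)=0$.
   Context: A strongly continuous semigroup on $X$ is a family $\{\Psi_t\}_{t\ge0}$ of bounded linear operators on $X$ with $\Psi_s\Psi_t=\Psi_{s+t}$ for $s,t\ge0$, $\Psi_0=I$, and $t\mapsto\Psi_t(x)$ norm continuous on $[0,\infty)$ for every $x\in X$. $\Psi_t^\sharp\colon X^\sharp\to X^\sharp$ is the dual operator: $\langle\Psi_t(x),f\rangle=\langle x,\Psi_t^\sharp(f)\rangle$ for $x\in X$, $f\in X^\sharp$. The $w^*$-infinitesimal generator of the dual semigroup is $\psi^\sharp(f)=w^*\text{-}\lim_{t\to0+}\frac{\Psi_t^\sharp(f)-f}{t}$, with domain $\operatorname{Dom}(\psi^\sharp)$ the set of all $f\in X^\sharp$ for which this $w^*$-limit exists in $X^\sharp$ (it coincides with the dual operator of the infinitesimal generator $\psi$ of $\{\Psi_t\}_{t\ge0}$). *)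

theory Defs
  imports "HOL-Analysis.Analysis"
begin

text \<open>
  A normed space over a scalar field \<open>'k\<close> is a real normed space \<open>'a\<close> together with a
  scalar multiplication by \<open>'k\<close> that extends the real one and for which the norm is
  homogeneous. Up to isomorphism the instances of class \<open>real_normed_field\<close> are exactly
  the real and the complex numbers, so both real and complex normed spaces are covered;
  with \<open>'a :: banach\<close> these are the real and complex Banach spaces.
\<close>

locale normed_space_over = vector_space smul
  for smul :: "'k::real_normed_field \<Rightarrow> 'a::real_normed_vector \<Rightarrow> 'a" +
  assumes scale_of_real: "smul (of_real r) x = r *\<^sub>R x"
    and norm_scale: "norm (smul c x) = norm c * norm x"

lemma normed_space_over_real:
  "normed_space_over (scaleR :: real \<Rightarrow> 'a::real_normed_vector \<Rightarrow> 'a)"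
  by unfold_locales (auto simp: algebra_simps)

lemma normed_space_over_self:
  "normed_space_over ((*) :: 'k::real_normed_field \<Rightarrow> 'k \<Rightarrow> 'k)"
  by unfold_locales (auto simp: algebra_simps norm_mult scaleR_conv_of_real)

text \<open>
  The type \<open>'a \<Rightarrow>\<^sub>L 'b\<close> only records boundedness and real-linearity, so linearity over \<open>'k\<close>
  is required separately.
\<close>

definition strongly_continuous_semigroup ::
    "('k::real_normed_field \<Rightarrow> 'a::real_normed_vector \<Rightarrow> 'a) \<Rightarrow> (real \<Rightarrow> 'a \<Rightarrow>\<^sub>L 'a) \<Rightarrow> bool" where
  "strongly_continuous_semigroup smul \<Psi> \<longleftrightarrow>
     (\<forall>t\<ge>0. Vector_Spaces.linear smul smul (blinfun_apply (\<Psi> t))) \<and>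
     (\<forall>s\<ge>0. \<forall>t\<ge>0. \<Psi> s o\<^sub>L \<Psi> t = \<Psi> (s + t)) \<and>
     \<Psi> 0 = id_blinfun \<and>
     (\<forall>x. continuous_on {0..} (\<lambda>t. \<Psi> t x))"

definition topological_dual ::
    "('k::real_normed_field \<Rightarrow> 'a::real_normed_vector \<Rightarrow> 'a) \<Rightarrow> ('a \<Rightarrow>\<^sub>L 'k) set" where
  "topological_dual smul = {f. Vector_Spaces.linear smul (*) (blinfun_apply f)}"

definition dual_operator ::
    "('a::real_normed_vector \<Rightarrow>\<^sub>L 'a) \<Rightarrow> ('a \<Rightarrow>\<^sub>L 'k::real_normed_field) \<Rightarrow> ('a \<Rightarrow>\<^sub>L 'k)" where
  "dual_operator T f = f o\<^sub>L T"

lemma dual_operator_apply: "blinfun_apply (dual_operator T f) x = f (T x)"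
  by (simp add: dual_operator_def)

lemma dual_operator_in_topological_dual:
  assumes "f \<in> topological_dual smul"
    and "Vector_Spaces.linear smul smul (blinfun_apply T)"
  shows "dual_operator T f \<in> topological_dual smul"
  using Vector_Spaces.linear_compose[OF assms(2), of "(*)" "blinfun_apply f"] assms(1)
  by (simp add: topological_dual_def dual_operator_def blinfun_compose.rep_eq o_def)

text \<open>
  For scalar-valued operators the strong operator topology is the topology of pointwise
  convergence, that is, the weak-star topology.
\<close>

definition weak_star_topology ::
    "('k::real_normed_field \<Rightarrow> 'a::real_normed_vector \<Rightarrow> 'a) \<Rightarrow> ('a \<Rightarrow>\<^sub>L 'k) topology" where
  "weak_star_topology smul =
     subtopology strong_operator_topology (topological_dual smul)"

lemma topspace_weak_star_topology [simp]:
  "topspace (weak_star_topology smul) = topological_dual smul"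
  by (simp add: weak_star_topology_def strong_operator_topology_topspace)

lemma Hausdorff_weak_star_topology:
  fixes smul :: "'k::real_normed_field \<Rightarrow> 'a::real_normed_vector \<Rightarrow> 'a"
  shows "Hausdorff_space (weak_star_topology smul)"
proof -
  have "Hausdorff_space (strong_operator_topology :: ('a \<Rightarrow>\<^sub>L 'k) topology)"
    unfolding Hausdorff_space_def
  proof (intro allI impI, elim conjE)
    fix f g :: "'a \<Rightarrow>\<^sub>L 'k"
    assume "f \<noteq> g"
    then obtain x where "blinfun_apply f x \<noteq> blinfun_apply g x"
      by (auto intro: blinfun_eqI)
    then obtain U V where UV: "open U" "open V" "blinfun_apply f x \<in> U" "blinfun_apply g x \<in> V"
        "U \<inter> V = {}"
      by (meson hausdorff)
    have "openin strong_operator_topology {h. blinfun_apply h x \<in> W}" if "open W" for W :: "'k set"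
      using strong_operator_topology_basis[of "{()}" "\<lambda>_. W" "\<lambda>_. x"] that by simp
    then show "\<exists>U V. openin strong_operator_topology U \<and> openin strong_operator_topology V \<and>
        f \<in> U \<and> g \<in> V \<and> disjnt U V"
      using UV by (intro exI[of _ "{h. blinfun_apply h x \<in> U}"] exI[of _ "{h. blinfun_apply h x \<in> V}"])
        (auto simp: disjnt_iff)
  qed
  then show ?thesis
    by (simp add: weak_star_topology_def Hausdorff_space_subtopology)
qed

text \<open>
  The weak-star infinitesimal generator of a family \<open>S\<close> of operators on the dual. The limit
  at \<open>0\<close> is unique because the topology is Hausdorff; the value of the generator is only
  meaningful on its domain.
\<close>

definition is_weak_star_derivative_at_0 ::
    "('k::real_normed_field \<Rightarrow> 'a::real_normed_vector \<Rightarrow> 'a) \<Rightarrow>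
     (real \<Rightarrow> ('a \<Rightarrow>\<^sub>L 'k) \<Rightarrow> ('a \<Rightarrow>\<^sub>L 'k)) \<Rightarrow> ('a \<Rightarrow>\<^sub>L 'k) \<Rightarrow> ('a \<Rightarrow>\<^sub>L 'k) \<Rightarrow> bool" where
  "is_weak_star_derivative_at_0 smul S f g \<longleftrightarrow>
     limitin (weak_star_topology smul) (\<lambda>t. (S t f - f) /\<^sub>R t) g (at_right 0)"

definition weak_star_generator_domain ::
    "('k::real_normed_field \<Rightarrow> 'a::real_normed_vector \<Rightarrow> 'a) \<Rightarrow>
     (real \<Rightarrow> ('a \<Rightarrow>\<^sub>L 'k) \<Rightarrow> ('a \<Rightarrow>\<^sub>L 'k)) \<Rightarrow> ('a \<Rightarrow>\<^sub>L 'k) set" where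
  "weak_star_generator_domain smul S =
     {f \<in> topological_dual smul. \<exists>g. is_weak_star_derivative_at_0 smul S f g}"

definition weak_star_generator ::
    "('k::real_normed_field \<Rightarrow> 'a::real_normed_vector \<Rightarrow> 'a) \<Rightarrow>
     (real \<Rightarrow> ('a \<Rightarrow>\<^sub>L 'k) \<Rightarrow> ('a \<Rightarrow>\<^sub>L 'k)) \<Rightarrow> ('a \<Rightarrow>\<^sub>L 'k) \<Rightarrow> ('a \<Rightarrow>\<^sub>L 'k)" where
  "weak_star_generator smul S f = (THE g. is_weak_star_derivative_at_0 smul S f g)"

lemma weak_star_generator_eqI:
  assumes "is_weak_star_derivative_at_0 smul S f g"
  shows "weak_star_generator smul S f = g"
  unfolding weak_star_generator_def
  using assms
  by (auto simp: is_weak_star_derivative_at_0_def intro!: the_equality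
      dest: limitin_Hausdorff_unique[OF _ _ trivial_limit_at_right_real Hausdorff_weak_star_topology])

end

theory Submission
  imports Defs
begin

text \<open>
  If \<open>f\<close> is fixed, its difference quotients vanish, and so does their limit.
  Conversely, suppose that the generator annihilates \<open>f\<close>, and take a vector \<open>x\<close>. The orbit function
  \<open>u t = f (\<Psi> t x)\<close> is norm continuous. By the semigroup law its difference quotient at \<open>t\<close>
  is the difference quotient of the dual semigroup at \<open>0\<close>, applied to \<open>f\<close> and evaluated at
  the vector \<open>\<Psi> t x\<close>; since weak-star limits are pointwise limits
  (\<open>weak_star_limit_pointwise\<close>), \<open>u\<close> has right derivative \<open>0\<close> at every \<open>t \<ge> 0\<close>. Only right
  derivatives come for free here, so the usual mean value theorem does not apply, but a
  continuous function whose right derivative vanishes everywhere is still constant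
  (\<open>zero_right_derivative_constant\<close>). Thus \<open>u t = u 0 = f x\<close> for every \<open>x\<close>.
\<close>

text \<open>
  A one-sided substitute for the mean value inequality. The bound cannot fail for
  a first time: at the infimum \<open>c\<close> of the points where it fails, it still holds by
  continuity from the left, and the local hypothesis then carries it a little beyond \<open>c\<close>.
\<close>

lemma norm_diff_le_if_locally_le_right:
  fixes u :: "real \<Rightarrow> 'a::real_normed_vector"
  assumes "a \<le> b" and cont: "continuous_on {a..b} u"
    and right: "\<And>t. a \<le> t \<Longrightarrow> t < b \<Longrightarrow>
      eventually (\<lambda>s. norm (u s - u t) \<le> e * (s - t)) (at_right t)"
  shows "norm (u b - u a) \<le> e * (b - a)"
proof (rule ccontr)
  assume fails: "\<not> ?thesis"
  define A where "A = {t \<in> {a..b}. norm (u t - u a) > e * (t - a)}"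
  define c where "c = Inf A"
  have "b \<in> A"
    using fails \<open>a \<le> b\<close> by (auto simp: A_def)
  have bdd: "bdd_below A"
    by (auto simp: A_def intro: bdd_belowI[of _ a])
  have "a \<le> c"
    unfolding c_def using \<open>b \<in> A\<close> by (intro cInf_greatest) (auto simp: A_def)
  have "c \<le> b"
    unfolding c_def using \<open>b \<in> A\<close> bdd by (intro cInf_lower)
  have below: "norm (u s - u a) \<le> e * (s - a)" if "a \<le> s" "s < c" for s
    using that \<open>c \<le> b\<close> cInf_lower[OF _ bdd, of s] by (force simp: A_def c_def)
  have at_c: "norm (u c - u a) \<le> e * (c - a)"
  proof (cases "c = a")
    case False
    then have "a < c"
      using \<open>a \<le> c\<close> by simp
    have "continuous_on {a..c} u"
      using \<open>c \<le> b\<close> by (intro continuous_on_subset[OF cont]) auto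
    then have lim: "(u \<longlongrightarrow> u c) (at_left c)"
      using \<open>a < c\<close> by (simp add: continuous_on_Icc_at_leftD)
    show ?thesis
    proof (rule tendsto_le[OF trivial_limit_at_left_real])
      show "((\<lambda>s. e * (s - a)) \<longlongrightarrow> e * (c - a)) (at_left c)"
        by (intro tendsto_intros)
      show "((\<lambda>s. norm (u s - u a)) \<longlongrightarrow> norm (u c - u a)) (at_left c)"
        by (intro tendsto_intros lim)
      show "eventually (\<lambda>s. norm (u s - u a) \<le> e * (s - a)) (at_left c)"
        using eventually_at_left_real[OF \<open>a < c\<close>] by eventually_elim (auto intro: below)
    qed
  qed simp
  with fails \<open>c \<le> b\<close> have "c < b"
    by (cases "c = b") auto
  from right[OF \<open>a \<le> c\<close> this] obtain d where "d > c"
    and d: "\<And>s. c < s \<Longrightarrow> s < d \<Longrightarrow> norm (u s - u c) \<le> e * (s - c)"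
    by (auto simp: eventually_at_right_field)
  have beyond: "norm (u s - u a) \<le> e * (s - a)" if "c < s" "s < d" for s
  proof -
    have "norm (u s - u a) \<le> norm (u s - u c) + norm (u c - u a)"
      using norm_triangle_ineq[of "u s - u c" "u c - u a"] by simp
    also have "\<dots> \<le> e * (s - c) + e * (c - a)"
      using d[OF that] at_c by (rule add_mono)
    finally show ?thesis
      by (simp add: algebra_simps)
  qed
  have "d \<le> s" if "s \<in> A" for s
    using that cInf_lower[OF that bdd] at_c beyond[of s]
    by (cases "s = c") (force simp: A_def c_def)+
  then have "d \<le> c"
    unfolding c_def using \<open>b \<in> A\<close> by (intro cInf_greatest) auto
  with \<open>d > c\<close> show False
    by simp
qed

text \<open>
  For every \<open>e > 0\<close> the vanishing right derivative gives the local bound with slope \<open>e\<close>;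
  the resulting bounds \<open>e * (b - a)\<close> tend to \<open>0\<close> with \<open>e\<close>.
\<close>

lemma zero_right_derivative_constant:
  fixes u :: "real \<Rightarrow> 'a::real_normed_vector"
  assumes "a \<le> b" and "continuous_on {a..b} u"
    and deriv: "\<And>t. a \<le> t \<Longrightarrow> t < b \<Longrightarrow>
      ((\<lambda>h. (u (t + h) - u t) /\<^sub>R h) \<longlongrightarrow> 0) (at_right 0)"
  shows "u b = u a"
proof -
  have "norm (u b - u a) \<le> e * (b - a)" if "e > 0" for e
    using assms(1,2)
  proof (rule norm_diff_le_if_locally_le_right)
    fix t assume "a \<le> t" "t < b"
    then have "eventually (\<lambda>h. norm ((u (t + h) - u t) /\<^sub>R h) < e) (at_right 0)"
      using tendstoD[OF deriv \<open>e > 0\<close>] by (simp add: dist_norm)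
    moreover have "eventually (\<lambda>h. h > 0) (at_right (0::real))"
      by (rule eventually_at_right_less)
    ultimately have "eventually (\<lambda>h. norm (u (h + t) - u t) \<le> e * (h + t - t)) (at_right 0)"
    proof eventually_elim
      case (elim h)
      then have "norm (u (t + h) - u t) / h < e"
        by (simp add: divide_inverse mult.commute)
      with \<open>h > 0\<close> show ?case
        by (simp add: pos_divide_less_eq add.commute)
    qed
    then show "eventually (\<lambda>s. norm (u s - u t) \<le> e * (s - t)) (at_right t)"
      by (simp add: eventually_at_right_to_0[of _ t])
  qed
  moreover have "((\<lambda>e. e * (b - a)) \<longlongrightarrow> 0 * (b - a)) (at_right 0)"
    by (intro tendsto_intros)
  ultimately have "norm (u b - u a) \<le> 0 * (b - a)"
    by (intro tendsto_lowerbound[OF _ _ trivial_limit_at_right_real])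
      (auto intro: eventually_mono[OF eventually_at_right_less])
  then show ?thesis
    by simp
qed

lemma weak_star_limit_pointwise:
  assumes "limitin (weak_star_topology smul) F g L"
  shows "((\<lambda>t. blinfun_apply (F t) x) \<longlongrightarrow> blinfun_apply g x) L"
proof -
  have "limitin strong_operator_topology F g L"
    using assms by (simp add: weak_star_topology_def limitin_subtopology)
  then show ?thesis
    using continuous_map_limit[OF strong_operator_topology_continuous_evaluation, of F g L x]
    by (simp add: o_def)
qed

lemma zero_in_topological_dual:
  assumes "f \<in> topological_dual smul"
  shows "0 \<in> topological_dual smul"
  using assms unfolding topological_dual_def Vector_Spaces.linear_iff by auto

theorem theorem2p5:
  fixes smul :: "'k::real_normed_field \<Rightarrow> 'a::banach \<Rightarrow> 'a"
    and \<Psi> :: "real \<Rightarrow> 'a \<Rightarrow>\<^sub>L 'a"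
    and f :: "'a \<Rightarrow>\<^sub>L 'k"
  assumes "normed_space_over smul"
    and "strongly_continuous_semigroup smul \<Psi>"
    and "f \<in> topological_dual smul"
  shows "(\<forall>t\<ge>0. dual_operator (\<Psi> t) f = f) \<longleftrightarrow>
    f \<in> weak_star_generator_domain smul (\<lambda>t. dual_operator (\<Psi> t)) \<and>
    weak_star_generator smul (\<lambda>t. dual_operator (\<Psi> t)) f = 0"
proof -
  let ?S = "\<lambda>t. dual_operator (\<Psi> t)"
  have semigroup: "\<Psi> t (\<Psi> s x) = \<Psi> (s + t) x" if "s \<ge> 0" "t \<ge> 0" for s t x
  proof -
    have "\<Psi> t o\<^sub>L \<Psi> s = \<Psi> (s + t)"
      using assms(2) that by (simp add: strongly_continuous_semigroup_def add.commute)
    then show ?thesis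
      by (metis blinfun_apply_blinfun_compose)
  qed
  have at_0: "\<Psi> 0 = id_blinfun"
    and cont: "\<And>x. continuous_on {0..} (\<lambda>t. \<Psi> t x)"
    using assms(2) by (auto simp: strongly_continuous_semigroup_def)
  have "f \<in> weak_star_generator_domain smul ?S \<and> weak_star_generator smul ?S f = 0
      \<longleftrightarrow> is_weak_star_derivative_at_0 smul ?S f 0"
    using assms(3) by (auto simp: weak_star_generator_domain_def weak_star_generator_eqI)
  also have "\<dots> \<longleftrightarrow> (\<forall>t\<ge>0. ?S t f = f)"
  proof
    assume "is_weak_star_derivative_at_0 smul ?S f 0"
    then have quotient: "((\<lambda>h. (f (\<Psi> h y) - f y) /\<^sub>R h) \<longlongrightarrow> 0) (at_right 0)" for y
      by (auto dest!: weak_star_limit_pointwise[where x = y]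
          simp: is_weak_star_derivative_at_0_def dual_operator_apply
          scaleR_blinfun.rep_eq minus_blinfun.rep_eq)
    show "\<forall>t\<ge>0. ?S t f = f"
    proof (intro allI impI blinfun_eqI)
      fix T :: real and x
      assume "T \<ge> 0"
      then have "f (\<Psi> T x) = f (\<Psi> 0 x)"
      proof (rule zero_right_derivative_constant)
        show "continuous_on {0..T} (\<lambda>t. f (\<Psi> t x))"
          by (intro continuous_intros continuous_on_subset[OF cont]) auto
        fix t :: real assume "t \<ge> 0"
        show "((\<lambda>h. (f (\<Psi> (t + h) x) - f (\<Psi> t x)) /\<^sub>R h) \<longlongrightarrow> 0) (at_right 0)"
          using quotient[of "\<Psi> t x"]
        proof (rule Lim_transform_eventually)
          show "eventually (\<lambda>h. (f (\<Psi> h (\<Psi> t x)) - f (\<Psi> t x)) /\<^sub>R h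
              = (f (\<Psi> (t + h) x) - f (\<Psi> t x)) /\<^sub>R h) (at_right 0)"
            using eventually_at_right_less[of "0::real"]
            by eventually_elim (simp add: semigroup \<open>t \<ge> 0\<close>)
        qed
      qed
      then show "?S T f x = f x"
        by (simp add: dual_operator_apply at_0)
    qed
  next
    assume fixed: "\<forall>t\<ge>0. ?S t f = f"
    have "eventually (\<lambda>t. (?S t f - f) /\<^sub>R t = 0) (at_right 0)"
      using eventually_at_right_less[of "0::real"] by eventually_elim (simp add: fixed)
    then show "is_weak_star_derivative_at_0 smul ?S f 0"
      unfolding is_weak_star_derivative_at_0_def
      using zero_in_topological_dual[OF assms(3)] by (intro limitin_eventually) auto
  qed
  finally show ?thesis
    by blast
qed

end
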